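(* Let $\mathfrak{sl}_2(\mathbb C)$ have standard basis $e,h,f$ with $[h,e]=2e$, $[h,f]=-2f$, $[e,f]=h$. Up to isomorphism, there are exactly two GD algebra structures on the Lie algebra $\mathfrak{sl}_2(\mathbb C)$: the trivial one (with $\circ=0$) and the structure whose only nonzero products of basis elements are $h\circ f=-2e$, $f\circ h=4e$, $f\circ f=-h$.
   Context: A Novikov algebra is a vector space with a bilinear product $\circ$ satisfying $(x\circ y)\circ z-x\circ(y\circ z)=(y\circ x)\circ z-y\circ(x\circ z)$ and $(x\circ y)\circ z=(x\circ z)\circ y$. A Gelfand--Dorfman (GD) algebra is a triple $(A,\circ,[\cdot,\cdot])$ such that $(A,\circ)$ is a Novikov algebra, $(A,[\cdot,\cdot])$ is a Lie algebra, and for all $x,y,z\in A$: $[x,y\circ z]-[z,y\circ x]+[y,x]\circ z-[y,z]\circ x-y\circ[x,z]=0$. A GD algebra structure on a Lie algebra $(\mathfrak g,[\cdot,\cdot])$ is a bilinear product $\circ$ making $(\mathfrak g,\circ,[\cdot,\cdot])$ a GD algebra. An isomorphism of GD algebras is a linear isomorphism preserving both $\circ$ and $[\cdot,\cdot]$. *)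

theory Defs
  imports "HOL-Analysis.Analysis"
begin

text \<open>Algebras over a field: a vector space is given by its scalar multiplication \<open>scale\<close>
  (as in the library locale \<open>vector_space\<close>), the underlying space being the whole type.\<close>

locale bilinear_product = vector_space scale
  for scale :: "'k::field \<Rightarrow> 'v::ab_group_add \<Rightarrow> 'v" +
  fixes prod :: "'v \<Rightarrow> 'v \<Rightarrow> 'v"
  assumes linear_right: "Vector_Spaces.linear scale scale (\<lambda>y. prod x y)"
    and linear_left: "Vector_Spaces.linear scale scale (\<lambda>x. prod x y)"

locale novikov_algebra = bilinear_product scale prod
  for scale :: "'k::field \<Rightarrow> 'v::ab_group_add \<Rightarrow> 'v"
    and prod :: "'v \<Rightarrow> 'v \<Rightarrow> 'v" +
  assumes left_symmetric:
      "prod (prod x y) z - prod x (prod y z) = prod (prod y x) z - prod y (prod x z)"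
    and right_commutative: "prod (prod x y) z = prod (prod x z) y"

locale lie_algebra = bilinear_product scale bracket
  for scale :: "'k::field \<Rightarrow> 'v::ab_group_add \<Rightarrow> 'v"
    and bracket :: "'v \<Rightarrow> 'v \<Rightarrow> 'v" +
  assumes alternating: "bracket x x = 0"
    and jacobi:
      "bracket x (bracket y z) + bracket y (bracket z x) + bracket z (bracket x y) = 0"

locale gd_algebra =
  novikov_algebra scale prod + lie: lie_algebra scale bracket
  for scale :: "'k::field \<Rightarrow> 'v::ab_group_add \<Rightarrow> 'v"
    and prod :: "'v \<Rightarrow> 'v \<Rightarrow> 'v"
    and bracket :: "'v \<Rightarrow> 'v \<Rightarrow> 'v" +
  assumes gd_compatible:
    "bracket x (prod y z) - bracket z (prod y x) + prod (bracket y x) z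
       - prod (bracket y z) x - prod y (bracket x z) = 0"

definition gd_structures ::
    "('k::field \<Rightarrow> 'v::ab_group_add \<Rightarrow> 'v) \<Rightarrow> ('v \<Rightarrow> 'v \<Rightarrow> 'v) \<Rightarrow> ('v \<Rightarrow> 'v \<Rightarrow> 'v) set"
  where "gd_structures s br = {p. gd_algebra s p br}"

locale gd_isomorphism =
  A: gd_algebra scale1 prod1 bracket1 + B: gd_algebra scale2 prod2 bracket2 +
  Vector_Spaces.linear scale1 scale2 \<phi>
  for scale1 :: "'k::field \<Rightarrow> 'v::ab_group_add \<Rightarrow> 'v" and prod1 bracket1
    and scale2 :: "'k \<Rightarrow> 'w::ab_group_add \<Rightarrow> 'w" and prod2 bracket2
    and \<phi> :: "'v \<Rightarrow> 'w" +
  assumes bij: "bij \<phi>"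
    and map_prod: "\<phi> (prod1 x y) = prod2 (\<phi> x) (\<phi> y)"
    and map_bracket: "\<phi> (bracket1 x y) = bracket2 (\<phi> x) (\<phi> y)"

definition gd_isomorphic ::
    "('k::field \<Rightarrow> 'v::ab_group_add \<Rightarrow> 'v) \<Rightarrow> ('v \<Rightarrow> 'v \<Rightarrow> 'v) \<Rightarrow> ('v \<Rightarrow> 'v \<Rightarrow> 'v) \<Rightarrow>
     ('k \<Rightarrow> 'w::ab_group_add \<Rightarrow> 'w) \<Rightarrow> ('w \<Rightarrow> 'w \<Rightarrow> 'w) \<Rightarrow> ('w \<Rightarrow> 'w \<Rightarrow> 'w) \<Rightarrow> bool"
  where "gd_isomorphic scale1 prod1 bracket1 scale2 prod2 bracket2 \<longleftrightarrow>
    (\<exists>\<phi>. gd_isomorphism scale1 prod1 bracket1 scale2 prod2 bracket2 \<phi>)"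

typedef sl2 = "{A :: complex^2^2. trace A = 0}"
  by (rule exI[of _ 0]) (simp add: trace_def)

setup_lifting type_definition_sl2

instantiation sl2 :: ab_group_add
begin

lift_definition zero_sl2 :: sl2 is 0 by (simp add: trace_def)
lift_definition plus_sl2 :: "sl2 \<Rightarrow> sl2 \<Rightarrow> sl2" is "(+)" by (simp add: trace_add)
lift_definition minus_sl2 :: "sl2 \<Rightarrow> sl2 \<Rightarrow> sl2" is "(-)" by (simp add: trace_sub)
lift_definition uminus_sl2 :: "sl2 \<Rightarrow> sl2" is uminus
  by (simp add: trace_def sum_negf)

instance
  by standard (transfer; simp add: algebra_simps)+

end

lift_definition scale_sl2 :: "complex \<Rightarrow> sl2 \<Rightarrow> sl2" is "\<lambda>c A. \<chi> i j. c * A $ i $ j"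
  by (simp add: trace_def sum_2 flip: distrib_left)

lift_definition bracket_sl2 :: "sl2 \<Rightarrow> sl2 \<Rightarrow> sl2" is "\<lambda>A B. A ** B - B ** A"
  by (metis trace_sub trace_mul_sym diff_self)

lift_definition e_sl2 :: sl2 is "vector [vector [0, 1], vector [0, 0]]"
  by (simp add: trace_def sum_2)

lift_definition h_sl2 :: sl2 is "vector [vector [1, 0], vector [0, -1]]"
  by (simp add: trace_def sum_2)

lift_definition f_sl2 :: sl2 is "vector [vector [0, 0], vector [1, 0]]"
  by (simp add: trace_def sum_2)

lemma vector_space_sl2: "vector_space scale_sl2"
  by unfold_locales (transfer; simp add: vec_eq_iff algebra_simps)+

lemma linear_sl2_iff:
  "Vector_Spaces.linear scale_sl2 scale_sl2 g \<longleftrightarrow>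
     (\<forall>x y. g (x + y) = g x + g y) \<and> (\<forall>c x. g (scale_sl2 c x) = scale_sl2 c (g x))"
  by (simp add: Vector_Spaces.linear_iff vector_space_pair_def vector_space_sl2)

lemma lie_algebra_sl2: "lie_algebra scale_sl2 bracket_sl2"
proof (intro lie_algebra.intro bilinear_product.intro vector_space_sl2
    bilinear_product_axioms.intro lie_algebra_axioms.intro)
  fix x y z :: sl2
  show "Vector_Spaces.linear scale_sl2 scale_sl2 (bracket_sl2 x)"
    unfolding linear_sl2_iff
    by (intro conjI allI; transfer;
        simp add: vec_eq_iff matrix_matrix_mult_def sum_2 algebra_simps)
  show "Vector_Spaces.linear scale_sl2 scale_sl2 (\<lambda>x. bracket_sl2 x y)"
    unfolding linear_sl2_iff
    by (intro conjI allI; transfer;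
        simp add: vec_eq_iff matrix_matrix_mult_def sum_2 algebra_simps)
  show "bracket_sl2 x x = 0"
    by transfer simp
  show "bracket_sl2 x (bracket_sl2 y z) + bracket_sl2 y (bracket_sl2 z x)
      + bracket_sl2 z (bracket_sl2 x y) = 0"
    by transfer (simp add: vec_eq_iff matrix_matrix_mult_def sum_2 algebra_simps)
qed

lemma bracket_sl2_basis:
  "bracket_sl2 h_sl2 e_sl2 = scale_sl2 2 e_sl2"
  "bracket_sl2 h_sl2 f_sl2 = scale_sl2 (-2) f_sl2"
  "bracket_sl2 e_sl2 f_sl2 = h_sl2"
  by (transfer; simp add: vec_eq_iff matrix_matrix_mult_def sum_2 forall_2)+

lemma sl2_basis_expansion:
  "\<exists>!(a, b, c). x = scale_sl2 a e_sl2 + scale_sl2 b h_sl2 + scale_sl2 c f_sl2"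
proof -
  have eq: "x = scale_sl2 a e_sl2 + scale_sl2 b h_sl2 + scale_sl2 c f_sl2 \<longleftrightarrow>
      a = Rep_sl2 x $ 1 $ 2 \<and> b = Rep_sl2 x $ 1 $ 1 \<and> c = Rep_sl2 x $ 2 $ 1" for a b c
    by transfer (auto simp: vec_eq_iff forall_2 trace_def sum_2 add_eq_0_iff)
  show ?thesis
    unfolding eq by auto
qed

end

theory Submission
  imports Defs
begin

text \<open>
  Rewrite the compatibility identity of a GD algebra in terms of the right multiplications
  \<open>R\<^sub>z y = y \<circ> z\<close>: it says exactly that \<open>z \<mapsto> R\<^sub>z\<close> is a 1-cocycle of the Lie algebra with values
  in the module of its linear endomorphisms. Hence every linear map \<open>T\<close> gives a solution, the
  coboundary \<open>x \<circ> y = [y, T x] + T [x, y]\<close> (\<open>gd_compatible_coboundary\<close>), and since the first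
  cohomology of \<open>sl\<^sub>2\<close> vanishes (Whitehead), there are no other solutions. Scalar \<open>T\<close> give zero,
  so over \<open>sl\<^sub>2\<close> the solutions form an 8-dimensional space, parametrised by \<open>T = S + ad a\<close> with \<open>S\<close>
  traceless and symmetric for the trace form and \<open>a\<close> in \<open>sl\<^sub>2\<close> (\<open>gd_sl2_coboundary_table\<close>).

  Right commutativity, \<open>R\<^sub>y R\<^sub>z = R\<^sub>z R\<^sub>y\<close>, is quadratic in \<open>(S, a)\<close>. It forces \<open>a = 0\<close> and makes \<open>S\<close>
  of rank at most one (\<open>gd_sl2_rank_one\<close>). Over the complex numbers this means
  \<open>S x = \<langle>u, x\<rangle> u\<close>, and tracelessness becomes \<open>\<langle>u, u\<rangle> = 0\<close>, that is, \<open>u\<close> is nilpotent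
  (\<open>gd_sl2_classification\<close>). Conversely every nilpotent \<open>u\<close> gives a GD structure
  (\<open>nilpotent_product_gd\<close>), because both ways of bracketing a triple product yield a multiple of
  \<open>\<langle>u, x\<rangle> \<langle>u, y\<rangle> \<langle>u, z\<rangle> u\<close>, which is symmetric in \<open>x, y, z\<close>.

  The construction \<open>u \<mapsto> \<circ>\<close> is equivariant under conjugation by invertible matrices, and every nonzero
  nilpotent \<open>u\<close> is conjugate to \<open>e\<close> (\<open>nilpotent_conjugate_e\<close>). So the structures are the trivial one, from
  \<open>u = 0\<close>, and a single further isomorphism class, represented by \<open>u = e\<close>; the multiplication
  table for \<open>u = e\<close> is the one in the theorem.
\<close>

section \<open>Coordinates and the trace form\<close>

definition sl2_of :: "complex \<Rightarrow> complex \<Rightarrow> complex \<Rightarrow> sl2"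
  where "sl2_of a b c = scale_sl2 a e_sl2 + scale_sl2 b h_sl2 + scale_sl2 c f_sl2"

text \<open>This is one quarter of the Killing form. It is the invariant form that identifies \<open>sl\<^sub>2\<close> with
  its dual.\<close>

lift_definition trace_form :: "sl2 \<Rightarrow> sl2 \<Rightarrow> complex" is "\<lambda>A B. trace (A ** B)" .

lemma sl2_of_cases [cases type: sl2]:
  obtains a b c where "x = sl2_of a b c"
  using sl2_basis_expansion[of x] unfolding sl2_of_def by auto

lemma Rep_sl2_of:
  "Rep_sl2 (sl2_of a b c) = vector [vector [b, a], vector [c, - b]]"
  unfolding sl2_of_def by transfer (simp add: vec_eq_iff forall_2)

lemma sl2_of_eq_iff [simp]:
  "sl2_of a b c = sl2_of a' b' c' \<longleftrightarrow> a = a' \<and> b = b' \<and> c = c'"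
  by (auto simp: Rep_sl2_of vec_eq_iff forall_2 simp flip: Rep_sl2_inject)

lemma zero_eq_sl2_of: "0 = sl2_of 0 0 0"
  and e_eq_sl2_of: "e_sl2 = sl2_of 1 0 0"
  and h_eq_sl2_of: "h_sl2 = sl2_of 0 1 0"
  and f_eq_sl2_of: "f_sl2 = sl2_of 0 0 1"
  unfolding sl2_of_def by (transfer; simp add: vec_eq_iff forall_2)+

lemma sl2_of_add: "sl2_of a b c + sl2_of a' b' c' = sl2_of (a + a') (b + b') (c + c')"
  and sl2_of_diff: "sl2_of a b c - sl2_of a' b' c' = sl2_of (a - a') (b - b') (c - c')"
  and sl2_of_minus: "- sl2_of a b c = sl2_of (- a) (- b) (- c)"
  and scale_sl2_of: "scale_sl2 r (sl2_of a b c) = sl2_of (r * a) (r * b) (r * c)"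
  unfolding sl2_of_def by (transfer; simp add: vec_eq_iff forall_2 algebra_simps)+

lemma bracket_sl2_of: "bracket_sl2 (sl2_of a b c) (sl2_of a' b' c') =
    sl2_of (2 * (b * a' - a * b')) (a * c' - c * a') (2 * (c * b' - b * c'))"
  unfolding sl2_of_def
  by transfer (simp add: vec_eq_iff forall_2 matrix_matrix_mult_def sum_2 algebra_simps)

lemma trace_form_of: "trace_form (sl2_of a b c) (sl2_of a' b' c') = a * c' + 2 * b * b' + c * a'"
  unfolding sl2_of_def
  by transfer (simp add: forall_2 matrix_matrix_mult_def trace_def sum_2 algebra_simps)

lemmas sl2_of_simps = sl2_of_add sl2_of_diff sl2_of_minus scale_sl2_of bracket_sl2_of trace_form_of

lemma bilinear_product_sl2_of:
  assumes "bilinear_product scale_sl2 Q"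
  shows "Q (sl2_of a b c) (sl2_of a' b' c') =
      scale_sl2 (a * a') (Q e_sl2 e_sl2) + scale_sl2 (a * b') (Q e_sl2 h_sl2)
    + scale_sl2 (a * c') (Q e_sl2 f_sl2) + scale_sl2 (b * a') (Q h_sl2 e_sl2)
    + scale_sl2 (b * b') (Q h_sl2 h_sl2) + scale_sl2 (b * c') (Q h_sl2 f_sl2)
    + scale_sl2 (c * a') (Q f_sl2 e_sl2) + scale_sl2 (c * b') (Q f_sl2 h_sl2)
    + scale_sl2 (c * c') (Q f_sl2 f_sl2)"
proof -
  interpret bilinear_product scale_sl2 Q by fact
  have "Q (x + y) z = Q x z + Q y z" "Q z (x + y) = Q z x + Q z y"
    "Q (scale_sl2 r x) z = scale_sl2 r (Q x z)" "Q z (scale_sl2 r x) = scale_sl2 r (Q z x)"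
    for x y z r
    using linear_right linear_left by (simp_all add: linear_sl2_iff)
  then show ?thesis
    by (simp add: sl2_of_def scale_right_distrib algebra_simps)
qed

lemma bilinear_product_sl2_eqI:
  assumes P: "bilinear_product scale_sl2 P" and Q: "bilinear_product scale_sl2 Q"
    and "\<And>x y. x \<in> {e_sl2, h_sl2, f_sl2} \<Longrightarrow> y \<in> {e_sl2, h_sl2, f_sl2} \<Longrightarrow> P x y = Q x y"
  shows "P = Q"
proof (intro ext)
  fix x y
  show "P x y = Q x y"
    by (cases x; cases y)
      (simp add: bilinear_product_sl2_of[OF P] bilinear_product_sl2_of[OF Q] assms(3))
qed

lemma bracket_sl2_bilinear:
  "bracket_sl2 (x + y) z = bracket_sl2 x z + bracket_sl2 y z"
  "bracket_sl2 z (x + y) = bracket_sl2 z x + bracket_sl2 z y"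
  "bracket_sl2 (scale_sl2 r x) z = scale_sl2 r (bracket_sl2 x z)"
  "bracket_sl2 z (scale_sl2 r x) = scale_sl2 r (bracket_sl2 z x)"
  "bracket_sl2 (- x) z = - bracket_sl2 x z"
  "bracket_sl2 z (- x) = - bracket_sl2 z x"
  "bracket_sl2 (x - y) z = bracket_sl2 x z - bracket_sl2 y z"
  "bracket_sl2 z (x - y) = bracket_sl2 z x - bracket_sl2 z y"
  "bracket_sl2 0 z = 0"
  "bracket_sl2 z 0 = 0"
  by (cases x; cases y; cases z; simp add: sl2_of_simps zero_eq_sl2_of algebra_simps)+

lemma trace_form_bilinear:
  "trace_form (x + y) z = trace_form x z + trace_form y z"
  "trace_form (scale_sl2 r x) z = r * trace_form x z"
  "trace_form (- x) z = - trace_form x z"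
  "trace_form z (- x) = - trace_form z x"
  "trace_form z (x + y) = trace_form z x + trace_form z y"
  "trace_form z (scale_sl2 r x) = r * trace_form z x"
  by (cases x; cases y; cases z; simp add: sl2_of_simps algebra_simps)+

text \<open>This is the invariance of the trace form, equivalently the cyclicity of \<open>trace (x y z)\<close>.\<close>

lemma trace_form_bracket: "trace_form x (bracket_sl2 y z) = trace_form (bracket_sl2 x y) z"
  by (cases x; cases y; cases z) (simp add: sl2_of_simps algebra_simps)

lemma bracket_sl2_swap: "bracket_sl2 y x = - bracket_sl2 x y"
  by (cases x; cases y) (simp add: sl2_of_simps algebra_simps)

lemma trace_form_bracket_self:
  "trace_form u (bracket_sl2 u x) = 0" "trace_form u (bracket_sl2 x u) = 0"
  by (cases x; cases u; simp add: sl2_of_simps algebra_simps)+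

section \<open>The product of a nilpotent element\<close>

text \<open>The map \<open>z \<mapsto> R\<^sub>z\<close>, \<open>R\<^sub>z y = y \<circ> z\<close>, satisfies the cocycle condition because here \<open>R\<^sub>z\<close> is the
  commutator of \<open>ad z\<close> with \<open>T\<close>; written out, everything cancels by the Jacobi identity, once inside
  \<open>T\<close> and once outside.\<close>

lemma (in lie_algebra) gd_compatible_coboundary:
  assumes add: "\<And>x y. T (x + y) = T x + T y"
  defines "p \<equiv> \<lambda>x y. bracket y (T x) + T (bracket x y)"
  shows "bracket x (p y z) - bracket z (p y x) + p (bracket y x) z - p (bracket y z) x
    - p y (bracket x z) = 0"
proof -
  have br_add: "bracket a (b + c) = bracket a b + bracket a c"
    "bracket (b + c) a = bracket b a + bracket c a" for a b c
    using linear_right linear_left by (simp_all add: Vector_Spaces.linear_iff)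
  have br_swap: "bracket a b = - bracket b a" for a b
    using alternating[of "a + b"] alternating[of a] alternating[of b]
    by (simp add: br_add eq_neg_iff_add_eq_0 add.commute)
  have T0: "T 0 = 0" using add[of 0 0] by simp
  have J: "bracket x (bracket z w) + bracket z (bracket w x) = bracket (bracket x z) w" for w
    using jacobi[of x z w] br_swap[of w "bracket x z"] by (simp add: add_eq_0_iff)
  have T_neg: "T (- a) = - T a" for a
    using add[of a "- a"] by (simp add: T0 add_eq_0_iff)
  have br_neg: "bracket a (- b) = - bracket a b" "bracket (- b) a = - bracket b a" for a b
    using linear_right[of a] linear_left[of a]
    by (metis (no_types, lifting) br_add add_cancel_right_left add_eq_0_iff right_minus)+
  have J': "bracket (bracket y x) z + bracket x (bracket y z) = bracket y (bracket x z)"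
    using jacobi[of x y z] br_swap[of z] br_swap[of z x] br_swap[of x y]
    by (simp add: br_neg algebra_simps add_eq_0_iff)
  have "bracket x (bracket z (T y)) + bracket z (bracket (T y) x) = bracket (bracket x z) (T y)"
    by (rule J)
  then have "bracket x (bracket z (T y)) - bracket z (bracket x (T y)) = bracket (bracket x z) (T y)"
    by (simp add: br_swap[of "T y"] br_neg)
  moreover have "T (bracket (bracket y x) z) - T (bracket (bracket y z) x) = T (bracket y (bracket x z))"
    unfolding J'[symmetric] add by (simp add: br_swap[of _ x] T_neg br_neg)
  ultimately show ?thesis
    unfolding p_def br_add by (simp add: algebra_simps)
qed

text \<open>For matrices with \<open>u u = 0\<close> one has \<open>[u, [u, x]] = - 2 u x u\<close>, and \<open>u x u = trace (u x) u\<close> since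
  \<open>u\<close> has rank one.\<close>

lemma bracket_nilpotent_twice:
  assumes "trace_form u u = 0"
  shows "bracket_sl2 u (bracket_sl2 u x) = scale_sl2 (- 2 * trace_form u x) u"
proof (cases u; cases x)
  fix a b c a' b' c' assume [simp]: "u = sl2_of a b c" "x = sl2_of a' b' c'"
  have "b * b = - (a * c)" using assms by (simp add: sl2_of_simps algebra_simps) algebra
  then show ?thesis by (simp add: sl2_of_simps) (intro conjI; algebra)
qed

text \<open>The coboundary product \<open>[y, T x] + T [x, y]\<close> of the rank one map \<open>T x = \<langle>u, x\<rangle> u\<close>.\<close>

definition nilpotent_product :: "sl2 \<Rightarrow> sl2 \<Rightarrow> sl2 \<Rightarrow> sl2" where
  "nilpotent_product u x y =
    bracket_sl2 y (scale_sl2 (trace_form u x) u) + scale_sl2 (trace_form u (bracket_sl2 x y)) u"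

interpretation sl2: vector_space scale_sl2 by (rule vector_space_sl2)

lemma trace_form_nilpotent_product:
  assumes "trace_form u u = 0"
  shows "trace_form u (nilpotent_product u x y) = 0"
  by (simp add: nilpotent_product_def trace_form_bracket_self trace_form_bilinear
      bracket_sl2_bilinear assms)

text \<open>By the previous lemma only the summand \<open>T [x \<circ> y, z]\<close> of \<open>(x \<circ> y) \<circ> z\<close> survives. Moving the
  brackets across the invariant form turns its coefficient into one with \<open>[u, [u, y]]\<close>.\<close>

lemma nilpotent_product_left:
  assumes u: "trace_form u u = 0"
  shows "nilpotent_product u (nilpotent_product u x y) z =
    scale_sl2 (2 * trace_form u x * trace_form u y * trace_form u z) u"
proof -
  have "trace_form u (bracket_sl2 (nilpotent_product u x y) z)
      = trace_form u x * trace_form u (bracket_sl2 (bracket_sl2 y u) z)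
        + trace_form u (bracket_sl2 x y) * trace_form u (bracket_sl2 u z)"
    by (simp add: nilpotent_product_def bracket_sl2_bilinear trace_form_bilinear)
  also have "trace_form u (bracket_sl2 u z) = 0"
    by (simp add: trace_form_bracket_self)
  also have "trace_form u (bracket_sl2 (bracket_sl2 y u) z)
      = trace_form (bracket_sl2 u (bracket_sl2 u (- y))) z"
    unfolding trace_form_bracket by (simp add: bracket_sl2_swap[of y u] bracket_sl2_bilinear)
  also have "\<dots> = 2 * trace_form u y * trace_form u z"
    by (simp add: bracket_nilpotent_twice[OF u] trace_form_bilinear)
  finally show ?thesis
    by (simp add: nilpotent_product_def[of u "nilpotent_product u x y"] trace_form_nilpotent_product[OF u]
        bracket_sl2_bilinear mult_ac)
qed

text \<open>Both summands of \<open>x \<circ> (y \<circ> z)\<close> contribute equally here, again through \<open>[u, [u, _]]\<close>.\<close>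

lemma nilpotent_product_right:
  assumes u: "trace_form u u = 0"
  shows "nilpotent_product u x (nilpotent_product u y z) =
    scale_sl2 (- 4 * trace_form u x * trace_form u y * trace_form u z) u"
proof -
  have uu: "bracket_sl2 u u = 0" by (cases u) (simp add: sl2_of_simps zero_eq_sl2_of)
  have "bracket_sl2 (nilpotent_product u y z) u
     = scale_sl2 (trace_form u y) (bracket_sl2 u (bracket_sl2 u z))"
    by (simp add: nilpotent_product_def bracket_sl2_bilinear uu bracket_sl2_swap[of z u]
        bracket_sl2_swap[of "bracket_sl2 u z" u])
  moreover have "trace_form u (bracket_sl2 x (nilpotent_product u y z))
     = trace_form u y * trace_form (bracket_sl2 u x) (bracket_sl2 z u)"
    by (simp add: nilpotent_product_def bracket_sl2_bilinear trace_form_bilinear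
        trace_form_bracket_self trace_form_bracket)
  moreover have "trace_form (bracket_sl2 u x) (bracket_sl2 z u)
     = trace_form (bracket_sl2 u (bracket_sl2 u x)) z"
    by (simp add: bracket_sl2_swap[of z u] bracket_sl2_swap[of "bracket_sl2 u x" u]
        trace_form_bracket trace_form_bilinear)
  ultimately have "nilpotent_product u x (nilpotent_product u y z) =
      scale_sl2 (- 2 * trace_form u x * trace_form u y * trace_form u z) u +
      scale_sl2 (- 2 * trace_form u x * trace_form u y * trace_form u z) u"
    by (simp add: nilpotent_product_def[of u x] bracket_sl2_bilinear bracket_nilpotent_twice[OF u]
        trace_form_bilinear mult_ac)
  then show ?thesis
    unfolding sl2.scale_left_distrib[symmetric] by simp
qed

lemma nilpotent_product_gd:
  assumes u: "trace_form u u = 0"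
  shows "gd_algebra scale_sl2 (nilpotent_product u) bracket_sl2"
proof -
  interpret lie_algebra scale_sl2 bracket_sl2 by (rule lie_algebra_sl2)
  show ?thesis
  proof (intro gd_algebra.intro novikov_algebra.intro bilinear_product.intro vector_space_sl2
      bilinear_product_axioms.intro novikov_algebra_axioms.intro gd_algebra_axioms.intro
      lie_algebra_sl2)
    show "Vector_Spaces.linear scale_sl2 scale_sl2 (nilpotent_product u x)" for x
      by (simp add: linear_sl2_iff nilpotent_product_def bracket_sl2_bilinear trace_form_bilinear
          sl2.scale_right_distrib sl2.scale_left_distrib algebra_simps)
  next
    show "Vector_Spaces.linear scale_sl2 scale_sl2 (\<lambda>x. nilpotent_product u x y)" for y
      by (simp add: linear_sl2_iff nilpotent_product_def bracket_sl2_bilinear trace_form_bilinear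
          sl2.scale_right_distrib sl2.scale_left_distrib algebra_simps)
  next
    fix x y z
    show "nilpotent_product u (nilpotent_product u x y) z
         - nilpotent_product u x (nilpotent_product u y z) =
       nilpotent_product u (nilpotent_product u y x) z
         - nilpotent_product u y (nilpotent_product u x z)"
      by (simp add: nilpotent_product_left[OF u] nilpotent_product_right[OF u] mult_ac)
    show "nilpotent_product u (nilpotent_product u x y) z = nilpotent_product u (nilpotent_product u x z) y"
      by (simp add: nilpotent_product_left[OF u] mult_ac)
    show "bracket_sl2 x (nilpotent_product u y z) - bracket_sl2 z (nilpotent_product u y x)
       + nilpotent_product u (bracket_sl2 y x) z - nilpotent_product u (bracket_sl2 y z) x
       - nilpotent_product u y (bracket_sl2 x z) = 0"
      unfolding nilpotent_product_def
      by (rule gd_compatible_coboundary[where T = "\<lambda>x. scale_sl2 (trace_form u x) u"])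
        (simp add: trace_form_bilinear sl2.scale_left_distrib)
  qed
qed

section \<open>Every structure comes from a nilpotent element\<close>

text \<open>The multiplication table of the coboundary product of \<open>T = S + ad a\<close>, where
  \<open>a = k e + l h + m f\<close> and \<open>S\<close> is the general traceless map that is symmetric for the trace form:
  \<open>S e = - s2 e + s3 h + s4 f\<close>, \<open>S h = 2 (s1 e + s2 h + s3 f)\<close>, \<open>S f = s0 e + s1 h - s2 f\<close>.
  With this choice, \<open>S x = \<langle>u, x\<rangle> u\<close> for a nilpotent \<open>u = \<alpha> e + \<beta> h + \<gamma> f\<close> has
  \<open>s0 = \<alpha>\<^sup>2\<close>, \<open>s1 = \<alpha> \<beta>\<close>, \<open>s2 = \<beta>\<^sup>2 = - \<alpha> \<gamma>\<close>, \<open>s3 = \<beta> \<gamma>\<close> and \<open>s4 = \<gamma>\<^sup>2\<close>.\<close>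

definition coboundary_table ::
  "(sl2 \<Rightarrow> sl2 \<Rightarrow> sl2) \<Rightarrow> complex \<Rightarrow> complex \<Rightarrow> complex \<Rightarrow> complex \<Rightarrow> complex \<Rightarrow>
   complex \<Rightarrow> complex \<Rightarrow> complex \<Rightarrow> bool"
  where "coboundary_table Q s0 s1 s2 s3 s4 k l m \<longleftrightarrow>
    Q e_sl2 e_sl2 = sl2_of (- 2 * s3 + 2 * m) s4 0 \<and>
    Q e_sl2 h_sl2 = sl2_of 0 (- 2 * s3 + 2 * m) (- 4 * s4) \<and>
    Q e_sl2 f_sl2 = sl2_of (2 * s1 - 2 * k) (3 * s2 - 2 * l) (4 * s3) \<and>
    Q h_sl2 e_sl2 = sl2_of (- 6 * s2 + 4 * l) (4 * s3) (2 * s4) \<and>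
    Q h_sl2 h_sl2 = sl2_of (4 * s1 - 4 * k) 0 (- 4 * s3 - 4 * m) \<and>
    Q h_sl2 f_sl2 = sl2_of (- 2 * s0) (- 4 * s1) (6 * s2 + 4 * l) \<and>
    Q f_sl2 e_sl2 = sl2_of (- 4 * s1) (- 3 * s2 - 2 * l) (- 2 * s3 - 2 * m) \<and>
    Q f_sl2 h_sl2 = sl2_of (4 * s0) (2 * s1 + 2 * k) 0 \<and>
    Q f_sl2 f_sl2 = sl2_of 0 (- s0) (2 * s1 + 2 * k)"

text \<open>Whitehead's lemma in degree one for this module, in coordinates: on basis triples, compatibility
  is a homogeneous linear system of rank 19 in the 27 structure constants, and the
  parametrisation by \<open>(S, a)\<close> exhausts its solutions.\<close>

lemma gd_sl2_coboundary_table: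
  assumes "gd_algebra scale_sl2 Q bracket_sl2"
  obtains s0 s1 s2 s3 s4 k l m where "coboundary_table Q s0 s1 s2 s3 s4 k l m"
proof -
  interpret gd_algebra scale_sl2 Q bracket_sl2 by fact
  have bil: "bilinear_product scale_sl2 Q" by unfold_locales
  obtain ee_e ee_h ee_f where ee: "Q e_sl2 e_sl2 = sl2_of ee_e ee_h ee_f" by (cases "Q e_sl2 e_sl2")
  obtain eh_e eh_h eh_f where eh: "Q e_sl2 h_sl2 = sl2_of eh_e eh_h eh_f" by (cases "Q e_sl2 h_sl2")
  obtain ef_e ef_h ef_f where ef: "Q e_sl2 f_sl2 = sl2_of ef_e ef_h ef_f" by (cases "Q e_sl2 f_sl2")
  obtain he_e he_h he_f where he: "Q h_sl2 e_sl2 = sl2_of he_e he_h he_f" by (cases "Q h_sl2 e_sl2")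
  obtain hh_e hh_h hh_f where hh: "Q h_sl2 h_sl2 = sl2_of hh_e hh_h hh_f" by (cases "Q h_sl2 h_sl2")
  obtain hf_e hf_h hf_f where hf: "Q h_sl2 f_sl2 = sl2_of hf_e hf_h hf_f" by (cases "Q h_sl2 f_sl2")
  obtain fe_e fe_h fe_f where fe: "Q f_sl2 e_sl2 = sl2_of fe_e fe_h fe_f" by (cases "Q f_sl2 e_sl2")
  obtain fh_e fh_h fh_f where fh: "Q f_sl2 h_sl2 = sl2_of fh_e fh_h fh_f" by (cases "Q f_sl2 h_sl2")
  obtain ff_e ff_h ff_f where ff: "Q f_sl2 f_sl2 = sl2_of ff_e ff_h ff_f" by (cases "Q f_sl2 f_sl2")
  note basis = e_eq_sl2_of h_eq_sl2_of f_eq_sl2_of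
  note table = ee eh ef he hh hf fe fh ff
  have E: "bracket_sl2 x (Q y z) - bracket_sl2 z (Q y x) + Q (bracket_sl2 y x) z
       - Q (bracket_sl2 y z) x - Q y (bracket_sl2 x z) = 0" for x y z by (rule gd_compatible)
  note F = E[of e_sl2 e_sl2 h_sl2] E[of e_sl2 e_sl2 f_sl2] E[of h_sl2 e_sl2 f_sl2]
    E[of e_sl2 h_sl2 h_sl2] E[of e_sl2 h_sl2 f_sl2] E[of h_sl2 h_sl2 f_sl2]
    E[of e_sl2 f_sl2 h_sl2] E[of e_sl2 f_sl2 f_sl2] E[of h_sl2 f_sl2 f_sl2]
  note G = F[unfolded basis zero_eq_sl2_of,
      simplified bilinear_product_sl2_of[OF bil] table sl2_of_simps sl2_of_eq_iff, simplified]
  \<comment> \<open>In \<open>H\<close> the nine \<open>e\<close>-components come first, then the \<open>h\<close>- and the \<open>f\<close>-components.\<close>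
  note H = G[THEN conjunct1] G[THEN conjunct2, THEN conjunct1] G[THEN conjunct2, THEN conjunct2]
  \<comment> \<open>The parameters are read off from eight structure constants, by inverting the table.\<close>
  define s0 where "s0 = - ff_h"
  define s4 where "s4 = ee_h"
  define s1 where "s1 = - fe_e / 4"
  define s3 where "s3 = ef_f / 4"
  define s2 where "s2 = (hf_f - he_e) / 12"
  define l where "l = (hf_f + he_e) / 8"
  define k where "k = fh_h / 2 - s1"
  define m where "m = ee_e / 2 + s3"
  have param: "ff_h = - s0" "ee_h = s4" "fe_e = - 4 * s1" "ef_f = 4 * s3" "hf_f = 6 * s2 + 4 * l"
    "he_e = - 6 * s2 + 4 * l" "fh_h = 2 * s1 + 2 * k" "ee_e = - 2 * s3 + 2 * m"
    by (simp_all add: s0_def s1_def s2_def s3_def s4_def k_def l_def m_def field_simps)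
  have cancel: "x = y" if "2 * x = 2 * y" for x y :: complex using that by simp
  \<comment> \<open>Compatibility makes \<open>eh_e\<close> and \<open>fh_f\<close> equal to \<open>hh_h\<close>, so that their vanishing sum kills all
    three.\<close>
  have "hh_h + eh_e + fh_f = 0"
    unfolding H(14)[symmetric] H(2)[symmetric] H(26)[symmetric] by simp
  then have "3 * hh_h = 0" unfolding H(12) H(24) by simp
  then have hh_h: "hh_h = 0" by simp
  have eh_e: "eh_e = 0" using H(12) hh_h by simp
  have eh_h: "eh_h = - 2 * s3 + 2 * m" using H(1) param(8) by simp
  have eh_f: "eh_f = - 4 * s4" using H(10) param(2) by algebra
  have fh_e: "fh_e = 4 * s0" using H(18) param(1) by algebra
  have fh_f: "fh_f = 0" using H(24) hh_h by simp
  have fe_h: "fe_h = - 3 * s2 - 2 * l"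
    by (rule cancel) (use H(26) fh_f param(5) in algebra)
  have ef_h: "ef_h = 3 * s2 - 2 * l"
    by (rule cancel) (use H(2) eh_e param(6) in algebra)
  have "hf_h = fe_e" using H(5)[unfolded H(3)] by simp
  then have hf_h: "hf_h = - 4 * s1" by (simp only: param(3))
  have hh_e: "hh_e = 4 * s1 - 4 * k" using H(15) param(7) hf_h by algebra
  have ef_e: "ef_e = 2 * s1 - 2 * k"
    by (rule cancel) (simp only: H(3) hh_e, simp add: algebra_simps)
  have he_h: "he_h = 4 * s3" using H(11)[unfolded eh_h param(4,8)] by algebra
  have he_f: "he_f = 2 * s4" using H(20)[unfolded eh_f param(2)] by algebra
  have hh_f: "hh_f = - 4 * s3 - 4 * m" using H(21)[unfolded eh_h param(4)] by algebra
  have "4 * hf_e = 4 * (- 2 * s0)" using H(6)[unfolded fh_e] by algebra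
  then have hf_e: "hf_e = - 2 * s0" by simp
  have fe_f: "fe_f = - 2 * s3 - 2 * m"
    by (rule cancel) (simp only: H(25) hh_f, simp add: algebra_simps)
  show ?thesis
    by (rule that[of s0 s1 s2 s3 s4 k l m])
      (simp add: coboundary_table_def table param H(9,19,27) eh_e eh_h eh_f ef_e ef_h he_h he_f hh_e hh_h hh_f
        hf_e hf_h fe_h fe_f fh_e fh_f)
qed

text \<open>The equations that right commutativity imposes on the products of the coordinates of \<open>S\<close> and
  \<open>a\<close> are graded by weight. If \<open>k \<noteq> 0\<close>, they can be solved one after the other from the top
  weight down, giving \<open>s0 = s1 = s2 = s3 = s4 = 0\<close>; if \<open>m \<noteq> 0\<close>, the same happens from the bottom; and if only
  \<open>l \<noteq> 0\<close>, each equation involving \<open>l\<close> reduces to a single term.\<close>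

lemma mixed_equations_imp_zero:
  fixes s0 s1 s2 s3 s4 k l m :: complex
  assumes "k * s0 = 0" "2 * k * s1 + l * s0 = 0" "3 * k * s2 - m * s0 + 2 * l * s1 = 0"
    "k * s3 + m * s1 = 0" "l * s2 = 0" "3 * m * s2 + 2 * l * s3 - k * s4 = 0"
    "2 * m * s3 + l * s4 = 0" "m * s4 = 0"
  shows "k = 0 \<and> l = 0 \<and> m = 0 \<or> s0 = 0 \<and> s1 = 0 \<and> s2 = 0 \<and> s3 = 0 \<and> s4 = 0"
proof -
  consider "k \<noteq> 0" | "m \<noteq> 0" | "k = 0" "m = 0" "l \<noteq> 0" | "k = 0" "m = 0" "l = 0" by blast
  then show ?thesis
    by cases (use assms in auto)
qed

text \<open>The equations for \<open>S\<close> are those of the cone over the rational normal quartic, that is, of the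
  traceless symmetric maps of rank at most one.\<close>

lemma gd_sl2_rank_one:
  assumes "gd_algebra scale_sl2 Q bracket_sl2"
  obtains s0 s1 s2 s3 s4 where
    "coboundary_table Q s0 s1 s2 s3 s4 0 0 0"
    "s1\<^sup>2 = s0 * s2" "s0 * s3 = - (s1 * s2)" "s0 * s4 = - (s1 * s3)" "s2\<^sup>2 = - (s1 * s3)"
    "s3\<^sup>2 = s2 * s4"
proof -
  interpret gd_algebra scale_sl2 Q bracket_sl2 by fact
  have bil: "bilinear_product scale_sl2 Q" by unfold_locales
  obtain s0 s1 s2 s3 s4 k l m where tab: "coboundary_table Q s0 s1 s2 s3 s4 k l m"
    using gd_sl2_coboundary_table[OF assms] by blast
  have table:
    "Q e_sl2 e_sl2 = sl2_of (- 2 * s3 + 2 * m) s4 0"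
    "Q e_sl2 h_sl2 = sl2_of 0 (- 2 * s3 + 2 * m) (- 4 * s4)"
    "Q e_sl2 f_sl2 = sl2_of (2 * s1 - 2 * k) (3 * s2 - 2 * l) (4 * s3)"
    "Q h_sl2 e_sl2 = sl2_of (- 6 * s2 + 4 * l) (4 * s3) (2 * s4)"
    "Q h_sl2 h_sl2 = sl2_of (4 * s1 - 4 * k) 0 (- 4 * s3 - 4 * m)"
    "Q h_sl2 f_sl2 = sl2_of (- 2 * s0) (- 4 * s1) (6 * s2 + 4 * l)"
    "Q f_sl2 e_sl2 = sl2_of (- 4 * s1) (- 3 * s2 - 2 * l) (- 2 * s3 - 2 * m)"
    "Q f_sl2 h_sl2 = sl2_of (4 * s0) (2 * s1 + 2 * k) 0"
    "Q f_sl2 f_sl2 = sl2_of 0 (- s0) (2 * s1 + 2 * k)"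
    using tab unfolding coboundary_table_def by blast+
  have E: "Q (Q x y) z = Q (Q x z) y" for x y z by (rule right_commutative)
  note F = E[of e_sl2 e_sl2 h_sl2] E[of e_sl2 e_sl2 f_sl2] E[of e_sl2 h_sl2 f_sl2]
    E[of h_sl2 e_sl2 h_sl2] E[of h_sl2 e_sl2 f_sl2] E[of h_sl2 h_sl2 f_sl2]
    E[of f_sl2 e_sl2 h_sl2] E[of f_sl2 e_sl2 f_sl2] E[of f_sl2 h_sl2 f_sl2]
  note G = F[unfolded table, unfolded e_eq_sl2_of h_eq_sl2_of f_eq_sl2_of,
      simplified bilinear_product_sl2_of[OF bil] table sl2_of_simps sl2_of_eq_iff, simplified]
  \<comment> \<open>In \<open>H\<close> the nine \<open>e\<close>-components come first, then the \<open>h\<close>- and the \<open>f\<close>-components.\<close>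
  note H = G[THEN conjunct1] G[THEN conjunct2, THEN conjunct1] G[THEN conjunct2, THEN conjunct2]
  have "k = 0 \<and> l = 0 \<and> m = 0 \<or> s0 = 0 \<and> s1 = 0 \<and> s2 = 0 \<and> s3 = 0 \<and> s4 = 0"
  proof (rule mixed_equations_imp_zero)
    show "k * s0 = 0" using H(9) by algebra
    show "2 * k * s1 + l * s0 = 0" using H(8) by algebra
    show "3 * k * s2 - m * s0 + 2 * l * s1 = 0" using H(15) by algebra
    show "k * s3 + m * s1 = 0" using H(12) H(16) by algebra
    show "l * s2 = 0" using H(14) by algebra
    show "3 * m * s2 + 2 * l * s3 - k * s4 = 0" using H(13) by algebra
    show "2 * m * s3 + l * s4 = 0" using H(20) by algebra
    show "m * s4 = 0" using H(19) by algebra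
  qed
  \<comment> \<open>If \<open>S = 0\<close>, three of the equations read \<open>k\<^sup>2 = 0\<close>, \<open>l\<^sup>2 = 0\<close> and \<open>m\<^sup>2 = 0\<close>.\<close>
  then have klm: "k = 0" "l = 0" "m = 0"
    using H(2) H(6) H(10) by auto
  show ?thesis
  proof (rule that[of s0 s1 s2 s3 s4])
    show "s1\<^sup>2 = s0 * s2" using H(6) unfolding klm by algebra
    show "s0 * s3 = - (s1 * s2)" using H(3) unfolding klm by algebra
    show "s0 * s4 = - (s1 * s3)" using H(12) unfolding klm by algebra
    show "s2\<^sup>2 = - (s1 * s3)" using H(2) H(12) unfolding klm by algebra
    show "s3\<^sup>2 = s2 * s4" using H(10) unfolding klm by algebra
  qed (use tab in \<open>simp add: klm\<close>)
qed

text \<open>A traceless symmetric map of rank at most one is \<open>\<langle>u, _\<rangle> u\<close> for a square root \<open>u\<close> over the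
  complex numbers; its trace is \<open>\<langle>u, u\<rangle>\<close>.\<close>

lemma gd_sl2_classification:
  assumes "gd_algebra scale_sl2 Q bracket_sl2"
  obtains u where "trace_form u u = 0" "Q = nilpotent_product u"
proof -
  interpret Q: gd_algebra scale_sl2 Q bracket_sl2 by fact
  obtain s0 s1 s2 s3 s4 where table: "coboundary_table Q s0 s1 s2 s3 s4 0 0 0"
    and minors: "s1\<^sup>2 = s0 * s2" "s0 * s3 = - (s1 * s2)" "s0 * s4 = - (s1 * s3)"
      "s2\<^sup>2 = - (s1 * s3)" "s3\<^sup>2 = s2 * s4"
    using gd_sl2_rank_one[OF assms] by blast
  \<comment> \<open>The coordinates of \<open>u\<close>: the first is a square root of \<open>s0\<close>, which determines the others unless it
    vanishes; if it does, only \<open>s4\<close> can be nonzero.\<close>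
  have "\<exists>a b c. s0 = a\<^sup>2 \<and> s1 = a * b \<and> s2 = b\<^sup>2 \<and> s2 = - (a * c) \<and> s3 = b * c \<and> s4 = c\<^sup>2"
  proof (cases "s0 = 0")
    case True
    then have "s1 = 0" "s2 = 0" "s3 = 0" using minors by auto
    then show ?thesis using True
      by (intro exI[of _ 0] exI[of _ 0] exI[of _ "csqrt s4"]) simp
  next
    case False
    define a where "a = csqrt s0"
    have a: "a\<^sup>2 = s0" "a \<noteq> 0" using False by (auto simp: a_def)
    show ?thesis
    proof (intro exI conjI)
      show "s0 = a\<^sup>2" using a by simp
      show "s1 = a * (s1 / a)" using a by simp
      show "s2 = (s1 / a)\<^sup>2" using a minors(1) False by (simp add: power_divide)
      show "s2 = - (a * (- s2 / a))" using a by simp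
      show "s3 = s1 / a * (- s2 / a)" using a minors(2) False
        by (simp add: field_simps power2_eq_square)
      show "s4 = (- s2 / a)\<^sup>2" using a minors(3,4) False by (simp add: power_divide field_simps)
    qed
  qed
  then obtain a b c where abc: "s0 = a\<^sup>2" "s1 = a * b" "s2 = b\<^sup>2" "b\<^sup>2 = - (a * c)"
    "s3 = b * c" "s4 = c\<^sup>2"
    by metis
  define u where "u = sl2_of a b c"
  have u: "trace_form u u = 0" using abc(4) unfolding u_def sl2_of_simps by algebra
  interpret P: gd_algebra scale_sl2 "nilpotent_product u" bracket_sl2 by (rule nilpotent_product_gd[OF u])
  have ac: "a * c = - (b * b)" "a * (c * z) = - (b * (b * z))" for z
    using abc(4) by algebra+
  have "Q = nilpotent_product u"
  proof (rule bilinear_product_sl2_eqI)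
    fix x y assume "x \<in> {e_sl2, h_sl2, f_sl2}" "y \<in> {e_sl2, h_sl2, f_sl2}"
    then show "Q x y = nilpotent_product u x y"
      by (elim insertE emptyE; simp only: table[unfolded coboundary_table_def];
          simp add: nilpotent_product_def u_def e_eq_sl2_of h_eq_sl2_of f_eq_sl2_of
            sl2_of_simps abc(1-3,5,6) power2_eq_square mult_ac ac)
  qed unfold_locales
  with u show ?thesis by (rule that)
qed

section \<open>Conjugation of nilpotent elements\<close>

text \<open>Conjugation respects matrix products and traces, hence everything built from them.\<close>

lemma sl2_conjugation:
  fixes g h :: "complex^2^2"
  assumes gh: "g ** h = mat 1" "h ** g = mat 1"
  obtains \<phi> where "bij \<phi>" "Vector_Spaces.linear scale_sl2 scale_sl2 \<phi>"
    "\<And>x y. \<phi> (bracket_sl2 x y) = bracket_sl2 (\<phi> x) (\<phi> y)"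
    "\<And>x y. trace_form (\<phi> x) (\<phi> y) = trace_form x y"
    "\<And>x. Rep_sl2 (\<phi> x) ** g = g ** Rep_sl2 x"
proof -
  define c where "c g h A = g ** A ** h" for g h A :: "complex^2^2"
  have tr: "trace (c g h A) = trace A" if "h ** g = mat 1" for g h A
    by (metis c_def that trace_mul_sym matrix_mul_assoc matrix_mul_lid)
  have inv: "c h g (c g h A) = A" if "h ** g = mat 1" for g h A
    unfolding c_def by (metis that matrix_mul_assoc matrix_mul_lid matrix_mul_rid)
  have mult: "c g h A ** c g h B = c g h (A ** B)" for A B
    unfolding c_def by (metis gh(2) matrix_mul_assoc matrix_mul_lid)
  define \<phi> where "\<phi> x = Abs_sl2 (c g h (Rep_sl2 x))" for x
  define \<psi> where "\<psi> x = Abs_sl2 (c h g (Rep_sl2 x))" for x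
  have R: "Rep_sl2 (\<phi> x) = c g h (Rep_sl2 x)" "Rep_sl2 (\<psi> x) = c h g (Rep_sl2 x)" for x
    unfolding \<phi>_def \<psi>_def using Rep_sl2[of x] by (simp_all add: Abs_sl2_inverse tr gh)
  show ?thesis
  proof (rule that)
    show "bij \<phi>"
      by (rule o_bij[of \<psi>]) (auto simp: fun_eq_iff R inv gh simp flip: Rep_sl2_inject)
    show "Vector_Spaces.linear scale_sl2 scale_sl2 \<phi>"
      unfolding linear_sl2_iff
      by (auto simp: R c_def plus_sl2.rep_eq scale_sl2.rep_eq vec_eq_iff forall_2
          matrix_matrix_mult_def sum_2 algebra_simps simp flip: Rep_sl2_inject)
    show "\<phi> (bracket_sl2 x y) = bracket_sl2 (\<phi> x) (\<phi> y)" for x y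
      unfolding Rep_sl2_inject[symmetric] bracket_sl2.rep_eq R mult
      by (simp add: c_def vec_eq_iff matrix_matrix_mult_def sum_2 algebra_simps)
    show "trace_form (\<phi> x) (\<phi> y) = trace_form x y" for x y
      by (simp add: trace_form.rep_eq R mult tr gh)
    show "Rep_sl2 (\<phi> x) ** g = g ** Rep_sl2 x" for x
      by (simp add: R c_def gh flip: matrix_mul_assoc)
  qed
qed

text \<open>A matrix with rows \<open>w\<close> and \<open>w u\<close> satisfies \<open>g u = e g\<close> because \<open>u u = 0\<close>. It is invertible
  as soon as \<open>w u \<noteq> 0\<close>, since then \<open>w\<close> and \<open>w u\<close> are independent. One of the two unit vectors
  serves as \<open>w\<close>.\<close>

lemma nilpotent_conjugate_e:
  assumes u: "trace_form u u = 0" "u \<noteq> 0"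
  obtains \<phi> where "bij \<phi>" "Vector_Spaces.linear scale_sl2 scale_sl2 \<phi>"
    "\<And>x y. \<phi> (bracket_sl2 x y) = bracket_sl2 (\<phi> x) (\<phi> y)"
    "\<And>x y. trace_form (\<phi> x) (\<phi> y) = trace_form x y"
    "\<phi> u = e_sl2"
proof -
  obtain a b c where abc: "u = sl2_of a b c" by (cases u)
  have nil: "b * b = - (a * c)" using u(1) by (simp add: abc sl2_of_simps) algebra
  define g :: "complex^2^2" where
    "g = (if a \<noteq> 0 then vector [vector [1, 0], vector [b, a]]
          else vector [vector [0, 1], vector [c, - b]])"
  have "det g \<noteq> 0"
    using u(2) nil by (auto simp: g_def det_2 abc zero_eq_sl2_of)
  then obtain h where g: "g ** h = mat 1" "h ** g = mat 1"
    by (auto simp: invertible_def simp flip: invertible_det_nz)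
  have gu: "g ** Rep_sl2 u = Rep_sl2 e_sl2 ** g"
    using nil by (auto simp: abc e_eq_sl2_of Rep_sl2_of g_def vec_eq_iff forall_2
        matrix_matrix_mult_def sum_2 mult_ac)
  obtain \<phi> where \<phi>: "bij \<phi>" "Vector_Spaces.linear scale_sl2 scale_sl2 \<phi>"
    "\<And>x y. \<phi> (bracket_sl2 x y) = bracket_sl2 (\<phi> x) (\<phi> y)"
    "\<And>x y. trace_form (\<phi> x) (\<phi> y) = trace_form x y"
    "\<And>x. Rep_sl2 (\<phi> x) ** g = g ** Rep_sl2 x"
    using sl2_conjugation[OF g] by blast
  have "Rep_sl2 (\<phi> u) ** g ** h = Rep_sl2 e_sl2 ** g ** h"
    by (simp add: \<phi>(5) gu)
  then have "\<phi> u = e_sl2"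
    by (simp add: g Rep_sl2_inject flip: matrix_mul_assoc)
  with \<phi> that show ?thesis by blast
qed

text \<open>The product is built from \<open>u\<close>, the bracket and the trace form, so a conjugation taking \<open>u\<close> to
  \<open>e\<close> carries one product to the other.\<close>

lemma nilpotent_product_isomorphic:
  assumes u: "trace_form u u = 0" "u \<noteq> 0"
  shows "gd_isomorphic scale_sl2 (nilpotent_product u) bracket_sl2
    scale_sl2 (nilpotent_product e_sl2) bracket_sl2"
proof -
  obtain \<phi> where \<phi>: "bij \<phi>" "Vector_Spaces.linear scale_sl2 scale_sl2 \<phi>"
    "\<And>x y. \<phi> (bracket_sl2 x y) = bracket_sl2 (\<phi> x) (\<phi> y)"
    "\<And>x y. trace_form (\<phi> x) (\<phi> y) = trace_form x y"
    "\<phi> u = e_sl2"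
    using nilpotent_conjugate_e[OF u] by blast
  have lin: "\<phi> (x + y) = \<phi> x + \<phi> y" "\<phi> (scale_sl2 r x) = scale_sl2 r (\<phi> x)" for x y r
    using \<phi>(2) by (simp_all add: linear_sl2_iff)
  have form: "trace_form e_sl2 (\<phi> x) = trace_form u x" for x
    using \<phi>(4)[of u x] by (simp add: \<phi>(5))
  have prod: "\<phi> (nilpotent_product u x y) = nilpotent_product e_sl2 (\<phi> x) (\<phi> y)" for x y
    by (simp add: nilpotent_product_def lin \<phi>(3,5) form form[of "bracket_sl2 x y", unfolded \<phi>(3)])
  have "trace_form e_sl2 e_sl2 = 0" by (simp add: e_eq_sl2_of sl2_of_simps)
  then show ?thesis
    unfolding gd_isomorphic_def
    by (intro exI[of _ \<phi>] gd_isomorphism.intro gd_isomorphism_axioms.intro nilpotent_product_gd u \<phi> prod)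
qed

lemma gd_isomorphic_refl:
  assumes "gd_algebra s p br"
  shows "gd_isomorphic s p br s p br"
proof -
  interpret gd_algebra s p br by fact
  show ?thesis unfolding gd_isomorphic_def
    by (intro exI[of _ "\<lambda>x. x"] gd_isomorphism.intro gd_isomorphism_axioms.intro assms)
      (simp_all add: bij_def linear_ident)
qed

lemma nilpotent_product_zero: "nilpotent_product 0 = (\<lambda>x y. 0)"
proof (intro ext)
  fix x y show "nilpotent_product 0 x y = 0"
    by (cases x; cases y) (simp add: nilpotent_product_def sl2_of_simps zero_eq_sl2_of)
qed

theorem corollary6p10:
  shows "\<exists>P.
    P \<in> gd_structures scale_sl2 bracket_sl2 \<and>
    P e_sl2 e_sl2 = 0 \<and> P e_sl2 h_sl2 = 0 \<and> P e_sl2 f_sl2 = 0 \<and>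
    P h_sl2 e_sl2 = 0 \<and> P h_sl2 h_sl2 = 0 \<and> P h_sl2 f_sl2 = scale_sl2 (-2) e_sl2 \<and>
    P f_sl2 e_sl2 = 0 \<and> P f_sl2 h_sl2 = scale_sl2 4 e_sl2 \<and> P f_sl2 f_sl2 = - h_sl2 \<and>
    (\<lambda>x y. 0) \<in> gd_structures scale_sl2 bracket_sl2 \<and>
    \<not> gd_isomorphic scale_sl2 P bracket_sl2 scale_sl2 (\<lambda>x y. 0) bracket_sl2 \<and>
    (\<forall>Q \<in> gd_structures scale_sl2 bracket_sl2.
       gd_isomorphic scale_sl2 Q bracket_sl2 scale_sl2 (\<lambda>x y. 0) bracket_sl2 \<or>
       gd_isomorphic scale_sl2 Q bracket_sl2 scale_sl2 P bracket_sl2)"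
proof (intro exI[of _ "nilpotent_product e_sl2"] conjI)
  have ee: "trace_form e_sl2 e_sl2 = 0" and zz: "trace_form 0 0 = 0"
    by (simp_all add: e_eq_sl2_of zero_eq_sl2_of sl2_of_simps)
  show "nilpotent_product e_sl2 \<in> gd_structures scale_sl2 bracket_sl2"
    by (simp add: gd_structures_def nilpotent_product_gd ee)
  have triv: "gd_algebra scale_sl2 (\<lambda>x y. 0) bracket_sl2"
    using nilpotent_product_gd[OF zz] by (simp add: nilpotent_product_zero)
  then show "(\<lambda>x y. 0) \<in> gd_structures scale_sl2 bracket_sl2"
    by (simp add: gd_structures_def)
  note calc = nilpotent_product_def e_eq_sl2_of h_eq_sl2_of f_eq_sl2_of zero_eq_sl2_of sl2_of_simps
  show "nilpotent_product e_sl2 e_sl2 e_sl2 = 0" by (simp add: calc)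
  show "nilpotent_product e_sl2 e_sl2 h_sl2 = 0" by (simp add: calc)
  show "nilpotent_product e_sl2 e_sl2 f_sl2 = 0" by (simp add: calc)
  show "nilpotent_product e_sl2 h_sl2 e_sl2 = 0" by (simp add: calc)
  show "nilpotent_product e_sl2 h_sl2 h_sl2 = 0" by (simp add: calc)
  show "nilpotent_product e_sl2 h_sl2 f_sl2 = scale_sl2 (- 2) e_sl2" by (simp add: calc)
  show "nilpotent_product e_sl2 f_sl2 e_sl2 = 0" by (simp add: calc)
  show "nilpotent_product e_sl2 f_sl2 h_sl2 = scale_sl2 4 e_sl2" by (simp add: calc)
  show "nilpotent_product e_sl2 f_sl2 f_sl2 = - h_sl2" by (simp add: calc)
  show "\<not> gd_isomorphic scale_sl2 (nilpotent_product e_sl2) bracket_sl2 scale_sl2 (\<lambda>x y. 0) bracket_sl2"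
  proof
    assume "gd_isomorphic scale_sl2 (nilpotent_product e_sl2) bracket_sl2 scale_sl2 (\<lambda>x y. 0) bracket_sl2"
    then obtain \<phi> where "gd_isomorphism scale_sl2 (nilpotent_product e_sl2) bracket_sl2
        scale_sl2 (\<lambda>x y. 0) bracket_sl2 \<phi>"
      by (auto simp: gd_isomorphic_def)
    then interpret gd_isomorphism scale_sl2 "nilpotent_product e_sl2" bracket_sl2
        scale_sl2 "\<lambda>x y. 0" bracket_sl2 \<phi> .
    \<comment> \<open>An isomorphism to the zero product kills \<open>f \<circ> f = - h\<close>.\<close>
    have "\<phi> (nilpotent_product e_sl2 f_sl2 f_sl2) = \<phi> 0" by (simp add: map_prod zero)
    then have "nilpotent_product e_sl2 f_sl2 f_sl2 = 0" using bij by (meson bij_is_inj injD)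
    then show False by (simp add: calc)
  qed
  show "\<forall>Q \<in> gd_structures scale_sl2 bracket_sl2.
       gd_isomorphic scale_sl2 Q bracket_sl2 scale_sl2 (\<lambda>x y. 0) bracket_sl2 \<or>
       gd_isomorphic scale_sl2 Q bracket_sl2 scale_sl2 (nilpotent_product e_sl2) bracket_sl2"
  proof
    fix Q assume "Q \<in> gd_structures scale_sl2 bracket_sl2"
    then obtain u where u: "trace_form u u = 0" "Q = nilpotent_product u"
      using gd_sl2_classification by (auto simp: gd_structures_def)
    show "gd_isomorphic scale_sl2 Q bracket_sl2 scale_sl2 (\<lambda>x y. 0) bracket_sl2 \<or>
       gd_isomorphic scale_sl2 Q bracket_sl2 scale_sl2 (nilpotent_product e_sl2) bracket_sl2"
      using nilpotent_product_isomorphic[OF u(1)] gd_isomorphic_refl[OF triv] nilpotent_product_zero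
      by (cases "u = 0") (simp_all add: u(2))
  qed
qed

end
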